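(* Let $\mathcal{R}=\mathcal{R}_0\oplus\mathcal{R}_1$ be a supercommutative ring, let $a_1,a_2,\ldots\in\mathcal{R}_0$ and $\beta_1,\beta_2,\ldots\in\mathcal{R}_1$. Define $K_0=1$, $K_1=a_1$, $L_1=\beta_1$ and, for $n\ge 2$, $$K_n=a_nK_{n-1}-K_{n-2}-\beta_nL_{n-1},\qquad L_n=\beta_nK_{n-1}+L_{n-1}.$$ For $n\ge1$ let $W_n$ be the word $(\beta_1,\beta_1,\beta_2,\beta_2,\ldots,\beta_n,\beta_n)$ of length $2n$ and $W'_n$ the word $(\beta_1,\beta_1,\ldots,\beta_{n-1},\beta_{n-1},\beta_n)$ of length $2n-1$. Then for every $n\ge 1$, $$K_n=\mathcal{E}[W_n],\qquad L_n=\mathcal{E}[W'_n],$$ where $\mathcal{E}[\cdot]$ is the sum over all admissible markings of the corresponding monomials, as defined in the context. (In words: the summands of $K_n$, resp. $L_n$, are obtained from the product $\beta_1\beta_1\beta_2\beta_2\cdots$ by striking out adjacent pairs and adjacent 4-tuples $\beta_i\beta_i\beta_{i+1}\beta_{i+1}$ in all possible ways, substituting $\beta_i\beta_i\to a_i$, $\beta_i\beta_{i+1}\to 1$, $\beta_i\beta_i\beta_{i+1}\beta_{i+1}\to -1$.)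
   Context: A supercommutative ring satisfies $xy=(-1)^{|x||y|}yx$ for homogeneous $x,y$ and $x^2=0$ for odd $x$; in particular odd elements anticommute and $\beta_i^2=0$. Rule (definition of $\mathcal{E}$): Let $w=(w_1,\ldots,w_m)$ be a word whose letters are among $\beta_1,\beta_2,\ldots$, and write $\iota(p)$ for the index of the letter at position $p$ (so $w_p=\beta_{\iota(p)}$), where in every word considered any two adjacent positions satisfy $\iota(p+1)=\iota(p)$ or $\iota(p+1)=\iota(p)+1$. An admissible marking of $w$ is a partition of $\{1,\ldots,m\}$ into blocks of consecutive positions, each block being either a singleton $\{p\}$, a pair $\{p,p+1\}$, or a quadruple $\{p,p+1,p+2,p+3\}$ with $\iota(p)=\iota(p+1)=i$ and $\iota(p+2)=\iota(p+3)=i+1$ for some $i$. The weight of a pair $\{p,p+1\}$ is $a_i$ if $\iota(p)=\iota(p+1)=i$, and $1$ if $\iota(p+1)=\iota(p)+1$; the weight of a quadruple is $-1$. The monomial of a marking is the product of the weights of all its pairs and quadruples, times the product $\beta_{\iota(p_1)}\beta_{\iota(p_2)}\cdots\beta_{\iota(p_k)}$ over its singleton positions $p_1<p_2<\cdots<p_k$ taken in increasing order. $\mathcal{E}[w]$ is the sum of the monomials of all admissible markings of $w$ (the empty word has $\mathcal{E}=1$). *)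

theory Defs
  imports "HOL-Library.Disjoint_Sets"
begin

text \<open>
  The sort \<open>{ring, monoid_mult}\<close> is that of unital rings in which \<open>0 = 1\<close> is allowed; the class
  \<open>ring_1\<close> would exclude the zero ring.  The first group of assumptions says that the ring is the
  internal direct sum of its additive subgroups \<open>R0\<close> and \<open>R1\<close>, the second one that the
  multiplication respects the grading.  That \<open>1 \<in> R0\<close> is a consequence.
\<close>

locale supercommutative_ring =
  fixes R0 R1 :: "'a::{ring, monoid_mult} set"
  assumes zero_even: "0 \<in> R0"
    and add_even: "\<lbrakk>x \<in> R0; y \<in> R0\<rbrakk> \<Longrightarrow> x + y \<in> R0"
    and uminus_even: "x \<in> R0 \<Longrightarrow> - x \<in> R0"
    and zero_odd: "0 \<in> R1"
    and add_odd: "\<lbrakk>x \<in> R1; y \<in> R1\<rbrakk> \<Longrightarrow> x + y \<in> R1"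
    and uminus_odd: "x \<in> R1 \<Longrightarrow> - x \<in> R1"
    and even_Int_odd: "R0 \<inter> R1 = {0}"
    and decompose: "\<exists>y\<in>R0. \<exists>z\<in>R1. x = y + z"
  assumes even_mult_even: "\<lbrakk>x \<in> R0; y \<in> R0\<rbrakk> \<Longrightarrow> x * y \<in> R0"
    and even_mult_odd: "\<lbrakk>x \<in> R0; y \<in> R1\<rbrakk> \<Longrightarrow> x * y \<in> R1"
    and odd_mult_even: "\<lbrakk>x \<in> R1; y \<in> R0\<rbrakk> \<Longrightarrow> x * y \<in> R1"
    and odd_mult_odd: "\<lbrakk>x \<in> R1; y \<in> R1\<rbrakk> \<Longrightarrow> x * y \<in> R0"
  assumes even_commute: "\<lbrakk>x \<in> R0; y \<in> R0 \<union> R1\<rbrakk> \<Longrightarrow> x * y = y * x"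
    and odd_anticommute: "\<lbrakk>x \<in> R1; y \<in> R1\<rbrakk> \<Longrightarrow> x * y = - (y * x)"
    and odd_square: "x \<in> R1 \<Longrightarrow> x * x = 0"

text \<open>
  A word in the formal letters \<open>\<beta>\<^sub>1, \<beta>\<^sub>2, \<dots>\<close> is represented by the list of the indices of its
  letters, so that distinct letters stay distinct even if their values in the ring coincide.
  Positions are counted from \<open>0\<close>, hence \<open>w ! p\<close> is the index \<open>\<iota>(p)\<close>.
\<close>

definition admissible_block :: "nat list \<Rightarrow> nat set \<Rightarrow> bool" where
  "admissible_block w B \<longleftrightarrow>
     (\<exists>p. B = {p}) \<or>
     (\<exists>p. B = {p, p + 1}) \<or>
     (\<exists>p i. B = {p, p + 1, p + 2, p + 3} \<and>
        w ! p = i \<and> w ! (p + 1) = i \<and> w ! (p + 2) = i + 1 \<and> w ! (p + 3) = i + 1)"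

definition admissible_marking :: "nat list \<Rightarrow> nat set set \<Rightarrow> bool" where
  "admissible_marking w P \<longleftrightarrow>
     partition_on {..<length w} P \<and> (\<forall>B\<in>P. admissible_block w B)"

text \<open>
  The words of interest satisfy \<open>w ! (p + 1) \<in> {w ! p, w ! p + 1}\<close>, so the second branch below
  is exactly the case \<open>w ! (p + 1) = w ! p + 1\<close>.
\<close>

definition pair_weight :: "(nat \<Rightarrow> 'a::{ring, monoid_mult}) \<Rightarrow> nat list \<Rightarrow> nat \<Rightarrow> 'a" where
  "pair_weight a w p = (if w ! (p + 1) = w ! p then a (w ! p) else 1)"

text \<open>
  The ring is not commutative, so all products are taken in increasing order of positions.  For
  the weights this choice is immaterial, as even elements are central.
\<close>

definition marking_monomial ::
  "(nat \<Rightarrow> 'a::{ring, monoid_mult}) \<Rightarrow> (nat \<Rightarrow> 'a) \<Rightarrow> nat list \<Rightarrow> nat set set \<Rightarrow> 'a" where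
  "marking_monomial a \<beta> w P =
     (\<Prod>p\<leftarrow>filter (\<lambda>p. {p, p + 1} \<in> P) [0..<length w]. pair_weight a w p) *
     (\<Prod>p\<leftarrow>filter (\<lambda>p. {p, p + 1, p + 2, p + 3} \<in> P) [0..<length w]. - 1) *
     (\<Prod>p\<leftarrow>filter (\<lambda>p. {p} \<in> P) [0..<length w]. \<beta> (w ! p))"

definition marking_sum ::
  "(nat \<Rightarrow> 'a::{ring, monoid_mult}) \<Rightarrow> (nat \<Rightarrow> 'a) \<Rightarrow> nat list \<Rightarrow> 'a" where
  "marking_sum a \<beta> w = (\<Sum>P | admissible_marking w P. marking_monomial a \<beta> w P)"

definition word_W :: "nat \<Rightarrow> nat list" where
  "word_W n = concat (map (\<lambda>i. [i, i]) [1..<n + 1])"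

definition word_W' :: "nat \<Rightarrow> nat list" where
  "word_W' n = concat (map (\<lambda>i. [i, i]) [1..<n]) @ [n]"

end

theory Submission imports Defs begin

text \<open>
  Splitting the markings of a word according to the block that contains the last position
  gives \<open>E(W n) = E(W' n) * \<beta> n + a n * E(W (n-1)) - E(W (n-2))\<close> and
  \<open>E(W' n) = E(W (n-1)) * \<beta> n + E(W' (n-1))\<close>.  Since \<open>K (n-1)\<close> is even and \<open>L n\<close> is odd, moving
  \<open>\<beta> n\<close> to the left turns the second recurrence into the one for \<open>L n\<close>, and
  \<open>L n * \<beta> n = - \<beta> n * L n = - \<beta> n * L (n-1)\<close> by \<open>(\<beta> n)\<^sup>2 = 0\<close> turns the first one into that for \<open>K n\<close>.
\<close>

section \<open>Blocks as intervals of positions\<close>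

definition admissible_interval :: "nat list \<Rightarrow> nat \<Rightarrow> nat \<Rightarrow> bool" where
  "admissible_interval w p k \<longleftrightarrow> k = 1 \<or> k = 2 \<or>
     k = 4 \<and> w ! (p + 1) = w ! p \<and> w ! (p + 2) = w ! p + 1 \<and> w ! (p + 3) = w ! p + 1"

lemma atLeastLessThan_numerals:
  fixes p :: nat
  shows "{p..<p + 1} = {p}" "{p..<p + 2} = {p, p + 1}" "{p..<p + 4} = {p, p + 1, p + 2, p + 3}"
  by auto

text \<open>Singletons, pairs and quadruples become intervals with \<open>k = 1, 2, 4\<close>, so
  later arguments treat the three kinds of blocks uniformly through a start and a length.\<close>

lemma admissible_block_iff:
  "admissible_block w B \<longleftrightarrow> (\<exists>p k. B = {p..<p + k} \<and> admissible_interval w p k)"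
proof -
  have "admissible_block w B \<longleftrightarrow> (\<exists>p. B = {p..<p + 1}) \<or> (\<exists>p. B = {p..<p + 2}) \<or>
      (\<exists>p. B = {p..<p + 4} \<and> admissible_interval w p 4)"
    unfolding admissible_block_def admissible_interval_def atLeastLessThan_numerals by simp
  moreover have "admissible_interval w p k \<longleftrightarrow>
      k = 1 \<or> k = 2 \<or> k = 4 \<and> admissible_interval w p 4" for p k
    by (auto simp: admissible_interval_def)
  ultimately show ?thesis by metis
qed

lemma admissible_block_append:
  assumes "B \<subseteq> {..<length w}"
  shows "admissible_block (w @ u) B \<longleftrightarrow> admissible_block w B"
  using assms unfolding admissible_block_def by (auto simp: nth_append)

text \<open>A block inside \<open>{..<m}\<close> that contains \<open>m - 1\<close> must end exactly
  at \<open>m\<close>, hence is determined by its length. The condition \<open>k \<le> m\<close>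
  keeps \<open>m - k\<close> from being truncated.\<close>

lemma admissible_blocks_last:
  assumes "w \<noteq> []"
  defines "m \<equiv> length w"
  shows "{B. admissible_block w B \<and> B \<subseteq> {..<m} \<and> m - 1 \<in> B} =
    (\<lambda>k. {m - k..<m}) ` {k. k \<le> m \<and> admissible_interval w (m - k) k}" (is "?L = ?R")
proof
  show "?L \<subseteq> ?R"
  proof
    fix B assume "B \<in> ?L"
    then obtain p k where B: "B = {p..<p + k}" "admissible_interval w p k"
      "B \<subseteq> {..<m}" "m - 1 \<in> B"
      by (auto simp: admissible_block_iff)
    then have "p + k - 1 \<in> B" "m - 1 < p + k" by auto
    then have "p + k = m" using B(3) assms by (auto simp: m_def Suc_le_eq)
    then show "B \<in> ?R" using B by (auto intro!: image_eqI[of _ _ k])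
  qed
  show "?R \<subseteq> ?L"
  proof safe
    fix k assume k: "k \<le> m" "admissible_interval w (m - k) k"
    then have "1 \<le> k" by (auto simp: admissible_interval_def)
    with k assms show "m - 1 \<in> {m - k..<m}" by auto
    show "admissible_block w {m - k..<m}"
      using k unfolding admissible_block_iff by (metis le_add_diff_inverse2)
  qed auto
qed

section \<open>Splitting the markings by their last block\<close>

lemma admissible_markings_last_block:
  assumes "u \<noteq> []" and "admissible_interval (w @ u) (length w) (length u)"
  defines "B \<equiv> {length w..<length (w @ u)}"
  shows "{P. admissible_marking (w @ u) P \<and> B \<in> P} = insert B ` {P. admissible_marking w P}"
proof -
  have B: "B \<noteq> {}" "{..<length (w @ u)} - B = {..<length w}" "B \<subseteq> {..<length (w @ u)}"
    using assms(1) by (auto simp: B_def)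
  have adm: "admissible_block (w @ u) B"
    unfolding admissible_block_iff using assms(2) B_def by auto
  \<comment> \<open>Deleting \<open>B\<close> and inserting \<open>B\<close> are inverse to each
    other. The other blocks stay inside \<open>w\<close>, where appending \<open>u\<close> does not
    change the letters they see.\<close>
  have "admissible_marking (w @ u) P \<and> B \<in> P \<longleftrightarrow>
      P \<in> insert B ` {P. admissible_marking w P}" for P
  proof
    assume P: "admissible_marking (w @ u) P \<and> B \<in> P"
    then have "partition_on {..<length (w @ u)} (insert B (P - {B}))"
      by (simp add: admissible_marking_def insert_absorb)
    moreover have "disjnt B (\<Union> (P - {B}))"
      using P unfolding admissible_marking_def partition_on_def disjoint_def disjnt_def by auto
    ultimately have part: "partition_on {..<length w} (P - {B})"
      using B partition_on_insert by metis
    moreover have "admissible_block w C" if "C \<in> P - {B}" for C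
    proof -
      have "C \<subseteq> {..<length w}" using part that by (auto simp: partition_on_def)
      then show ?thesis
        using that P admissible_block_append by (auto simp: admissible_marking_def)
    qed
    ultimately have "admissible_marking w (P - {B})"
      by (simp add: admissible_marking_def)
    then show "P \<in> insert B ` {P. admissible_marking w P}"
      using P by (metis (no_types, lifting) image_eqI insert_Diff mem_Collect_eq)
  next
    assume "P \<in> insert B ` {P. admissible_marking w P}"
    then obtain Q where Q: "P = insert B Q" "admissible_marking w Q" by auto
    then have part: "partition_on {..<length w} Q" by (simp add: admissible_marking_def)
    then have "disjnt B (\<Union>Q)"
      using B unfolding partition_on_def disjnt_def by auto
    then have "partition_on {..<length (w @ u)} P"
      unfolding Q using partition_on_insert part B by metis
    moreover have "admissible_block (w @ u) C" if "C \<in> P" for C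
    proof (cases "C = B")
      case False
      then have "C \<in> Q" "C \<subseteq> {..<length w}"
        using that Q part by (auto simp: partition_on_def)
      then show ?thesis
        using Q admissible_block_append by (auto simp: admissible_marking_def)
    qed (simp add: adm)
    ultimately show "admissible_marking (w @ u) P \<and> B \<in> P"
      by (simp add: admissible_marking_def Q)
  qed
  then show ?thesis by blast
qed

lemma finite_admissible_markings: "finite {P. admissible_marking w P}"
  using finitely_many_partition_on[of "{..<length w}"]
  by (rule rev_finite_subset) (auto simp: admissible_marking_def)

text \<open>The last position is covered by some block because a marking is a partition, and by only
  one because blocks are disjoint. The classes of markings with a given last block are therefore
  disjoint and exhaust all markings; they are then indexed by the length of that block.\<close>

lemma marking_sum_split_last:
  assumes "w \<noteq> []"
  defines "m \<equiv> length w"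
  shows "marking_sum a \<beta> w = (\<Sum>k | k \<le> m \<and> admissible_interval w (m - k) k.
    \<Sum>P | admissible_marking w P \<and> {m - k..<m} \<in> P. marking_monomial a \<beta> w P)"
proof -
  define S where "S = {B. admissible_block w B \<and> B \<subseteq> {..<m} \<and> m - 1 \<in> B}"
  define I where "I = {k. k \<le> m \<and> admissible_interval w (m - k) k}"
  have S: "S = (\<lambda>k. {m - k..<m}) ` I"
    unfolding S_def I_def m_def by (rule admissible_blocks_last[OF assms(1)])
  have fin: "finite I" unfolding I_def by auto
  \<comment> \<open>The length is recovered as the cardinality of the interval.\<close>
  have inj: "inj_on (\<lambda>k. {m - k..<m}) I"
    by (rule inj_on_inverseI[of _ card]) (auto simp: I_def)
  have "\<exists>B\<in>S. B \<in> P" if "admissible_marking w P" for P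
  proof -
    have "m - 1 \<in> \<Union>P" "\<Union>P = {..<m}"
      using that assms by (auto simp: admissible_marking_def partition_on_def m_def)
    moreover from this obtain B where "B \<in> P" "m - 1 \<in> B" by blast
    ultimately show ?thesis using that by (auto simp: S_def admissible_marking_def)
  qed
  then have eq: "{P. admissible_marking w P} = (\<Union>B\<in>S. {P. admissible_marking w P \<and> B \<in> P})"
    by blast
  have "B = C" if "B \<in> S" "C \<in> S" "admissible_marking w P" "B \<in> P" "C \<in> P" for B C P
    using that unfolding S_def admissible_marking_def partition_on_def disjoint_def by blast
  then have "marking_sum a \<beta> w =
      (\<Sum>B\<in>S. \<Sum>P | admissible_marking w P \<and> B \<in> P. marking_monomial a \<beta> w P)"
    unfolding marking_sum_def eq using fin
    by (intro sum.UNION_disjoint ballI impI)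
      (auto simp: S intro: finite_subset[OF _ finite_admissible_markings[of w]])
  also have "\<dots> = (\<Sum>k\<in>I.
      \<Sum>P | admissible_marking w P \<and> {m - k..<m} \<in> P. marking_monomial a \<beta> w P)"
    unfolding S using inj by (simp add: sum.reindex)
  finally show ?thesis unfolding I_def .
qed

section \<open>The effect of the last block on monomials\<close>

lemma marking_monomial_insert_last:
  assumes "admissible_marking w P" "u \<noteq> []"
  defines "B \<equiv> {length w..<length (w @ u)}"
  shows "marking_monomial a \<beta> (w @ u) (insert B P) =
     ((\<Prod>p\<leftarrow>filter (\<lambda>p. {p, p + 1} \<in> P) [0..<length w]. pair_weight a w p) *
       (if length u = 2 then pair_weight a (w @ u) (length w) else 1)) *
     ((\<Prod>p\<leftarrow>filter (\<lambda>p. {p, p + 1, p + 2, p + 3} \<in> P) [0..<length w]. - 1) *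
       (if length u = 4 then - 1 else 1)) *
     ((\<Prod>p\<leftarrow>filter (\<lambda>p. {p} \<in> P) [0..<length w]. \<beta> (w ! p)) *
       (if length u = 1 then \<beta> (hd u) else 1))"
proof -
  define m k where "m = length w" and "k = length u"
  have B: "B = {m..<m + k}" "0 < k" using assms by (auto simp: m_def k_def)
  have sub: "C \<subseteq> {..<m}" if "C \<in> P" for C
    using that assms(1) unfolding admissible_marking_def partition_on_def m_def by blast
  \<comment> \<open>This serves the three products at once, with \<open>j = 2, 4, 1\<close>. Blocks
    of \<open>P\<close> start before \<open>m\<close> and the new block starts at \<open>m\<close>,
    so a product gains at most one factor, at its right end. The functions \<open>f\<close> and
    \<open>g\<close> read letters of \<open>w @ u\<close> and of \<open>w\<close>; they have to
    agree only where a block of \<open>P\<close> starts.\<close>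
  have split: "(\<Prod>p\<leftarrow>filter (\<lambda>p. {p..<p + j} \<in> insert B P) [0..<m + k]. f p) =
      (\<Prod>p\<leftarrow>filter (\<lambda>p. {p..<p + j} \<in> P) [0..<m]. g p) * (if k = j then f m else 1)"
    if "0 < j" "\<And>p. {p..<p + j} \<in> P \<Longrightarrow> p < m \<Longrightarrow> f p = g p" for f g :: "nat \<Rightarrow> 'a" and j
  proof -
    have ivl: "{p..<p + j} = {m..<m + k} \<longleftrightarrow> p = m \<and> k = j" for p
      using B(2) that(1) by (auto simp: atLeastLessThan_eq_iff)
    have "filter (\<lambda>p. {p..<p + j} \<in> insert B P) [0..<m] = filter (\<lambda>p. {p..<p + j} \<in> P) [0..<m]"
      by (rule filter_cong) (auto simp: B ivl)
    moreover have no: "{p..<p + j} \<notin> P" if "m \<le> p" for p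
      using sub[of "{p..<p + j}"] that \<open>0 < j\<close> by (metis atLeastLessThan_iff lessThan_iff
          less_add_same_cancel1 linorder_not_less order_refl subsetD)
    moreover have "filter (\<lambda>p. {p..<p + j} \<in> insert B P) [m..<m + k] = (if k = j then [m] else [])"
    proof -
      have "filter (\<lambda>p. {p..<p + j} \<in> insert B P) [m..<m + k] =
          filter (\<lambda>p. p = m \<and> k = j) [m..<m + k]"
        using no by (intro filter_cong) (auto simp: B(1) ivl)
      also have "\<dots> = (if k = j then [m] else [])"
        using B(2) by (auto simp: upt_conv_Cons filter_empty_conv)
      finally show ?thesis .
    qed
    moreover have "[0..<m + k] = [0..<m] @ [m..<m + k]"
      by (rule upt_add_eq_append) simp
    moreover have "(\<Prod>p\<leftarrow>filter (\<lambda>p. {p..<p + j} \<in> P) [0..<m]. f p) =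
        (\<Prod>p\<leftarrow>filter (\<lambda>p. {p..<p + j} \<in> P) [0..<m]. g p)"
      using that(2) by (intro arg_cong[of _ _ prod_list] map_cong) auto
    ultimately show ?thesis by simp
  qed
  \<comment> \<open>The weight also reads position \<open>p + 1\<close>, so \<open>p < m\<close>
    alone would not be enough: it is the block lying in \<open>P\<close> that puts both positions
    inside \<open>w\<close>.\<close>
  have pw: "pair_weight a (w @ u) p = pair_weight a w p" if "{p..<p + 2} \<in> P" for p
    using sub[OF that] by (auto simp: pair_weight_def nth_append m_def subset_iff)
  have bt: "\<beta> ((w @ u) ! p) = \<beta> (w ! p)" if "p < m" for p
    using that by (simp add: nth_append m_def)
  have hd: "(w @ u) ! m = hd u" using assms(2) by (simp add: m_def nth_append hd_conv_nth)
  have len: "length (w @ u) = m + k" by (simp add: m_def k_def)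
  show ?thesis
    unfolding marking_monomial_def len m_def[symmetric] k_def[symmetric]
    using split[of 2 "pair_weight a (w @ u)" "pair_weight a w"] split[of 4 "\<lambda>_. - 1" "\<lambda>_. - 1"]
      split[of 1 "\<lambda>p. \<beta> ((w @ u) ! p)" "\<lambda>p. \<beta> (w ! p)"] pw bt hd
    unfolding atLeastLessThan_numerals by simp
qed

text \<open>The contribution to \<open>marking_sum a \<beta> (w @ u)\<close> of the markings whose
  last block covers exactly the suffix \<open>u\<close>.\<close>

definition marking_sum_last ::
  "(nat \<Rightarrow> 'a::{ring, monoid_mult}) \<Rightarrow> (nat \<Rightarrow> 'a) \<Rightarrow> nat list \<Rightarrow> nat list \<Rightarrow> 'a" where
  "marking_sum_last a \<beta> w u =
     (\<Sum>P | admissible_marking (w @ u) P \<and> {length w..<length (w @ u)} \<in> P.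
       marking_monomial a \<beta> (w @ u) P)"

text \<open>Inserting the last block is injective on the markings of \<open>w\<close>: that block
  contains the position \<open>length w\<close>, which no block of such a marking does.\<close>

lemma marking_sum_last_eq:
  assumes "u \<noteq> []" and "admissible_interval (w @ u) (length w) (length u)"
  shows "marking_sum_last a \<beta> w u = (\<Sum>P | admissible_marking w P.
     marking_monomial a \<beta> (w @ u) (insert {length w..<length (w @ u)} P))"
proof -
  have "inj_on (insert {length w..<length (w @ u)}) {P. admissible_marking w P}"
  proof (rule inj_onI)
    fix P Q
    assume *: "P \<in> {P. admissible_marking w P}" "Q \<in> {P. admissible_marking w P}"
      "insert {length w..<length (w @ u)} P = insert {length w..<length (w @ u)} Q"
    have "{length w..<length (w @ u)} \<notin> X" if "admissible_marking w X" for X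
    proof
      assume "{length w..<length (w @ u)} \<in> X"
      moreover have "length w \<in> {length w..<length (w @ u)}" using assms(1) by simp
      ultimately have "length w \<in> \<Union>X" by blast
      moreover have "\<Union>X = {..<length w}"
        using that by (simp add: admissible_marking_def partition_on_def)
      ultimately show False by (metis lessThan_iff less_irrefl)
    qed
    with * show "P = Q" by (metis insert_ident mem_Collect_eq)
  qed
  then show ?thesis
    unfolding marking_sum_last_def admissible_markings_last_block[OF assms]
    by (simp add: sum.reindex)
qed

text \<open>A singleton at the last position contributes the rightmost letter of the monomial, so
  \<open>\<beta> x\<close> factors out on the right.\<close>

lemma marking_sum_last_singleton:
  "marking_sum_last a \<beta> w [x] = marking_sum a \<beta> w * \<beta> x"
proof -
  have "marking_sum_last a \<beta> w [x] =
      (\<Sum>P | admissible_marking w P. marking_monomial a \<beta> w P * \<beta> x)"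
    using marking_monomial_insert_last[of w _ "[x]" a \<beta>]
    by (subst marking_sum_last_eq)
      (auto simp: admissible_interval_def marking_monomial_def mult.assoc intro!: sum.cong)
  then show ?thesis by (simp add: marking_sum_def sum_distrib_right)
qed

lemma prod_list_commute:
  fixes c :: "'a::monoid_mult"
  assumes "\<And>x. x \<in> set xs \<Longrightarrow> c * x = x * c"
  shows "c * prod_list xs = prod_list xs * c"
  using assms by (induction xs) (simp_all, metis mult.assoc)

text \<open>The new weight appears to the right of the older pair weights and has to be moved to the
  front past them. If \<open>y\<close> differs from \<open>x\<close> the weight is \<open>1\<close>,
  so commutation is assumed only for \<open>y = x\<close>.\<close>

lemma marking_sum_last_pair:
  assumes "\<And>i. y = x \<Longrightarrow> i \<in> set w \<Longrightarrow> a x * a i = a i * a x"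
  shows "marking_sum_last a \<beta> w [x, y] = (if y = x then a x else 1) * marking_sum a \<beta> w"
proof -
  define c where "c = (if y = x then a x else 1)"
  have c: "pair_weight a (w @ [x, y]) (length w) = c"
    by (simp add: pair_weight_def nth_append c_def)
  have "marking_sum_last a \<beta> w [x, y] =
      (\<Sum>P | admissible_marking w P. c * marking_monomial a \<beta> w P)"
  proof (subst marking_sum_last_eq)
    have "marking_monomial a \<beta> (w @ [x, y]) (insert {length w..<length (w @ [x, y])} P) =
        c * marking_monomial a \<beta> w P" if "admissible_marking w P" for P
    proof -
      have "c * (\<Prod>p\<leftarrow>filter (\<lambda>p. {p, p + 1} \<in> P) [0..<length w]. pair_weight a w p) =
          (\<Prod>p\<leftarrow>filter (\<lambda>p. {p, p + 1} \<in> P) [0..<length w]. pair_weight a w p) * c"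
        by (rule prod_list_commute) (auto simp: pair_weight_def c_def assms)
      with c show ?thesis
        by (subst marking_monomial_insert_last[OF that])
          (simp_all add: marking_monomial_def mult.assoc[symmetric])
    qed
    then show "(\<Sum>P | admissible_marking w P. marking_monomial a \<beta> (w @ [x, y])
        (insert {length w..<length (w @ [x, y])} P)) =
        (\<Sum>P | admissible_marking w P. c * marking_monomial a \<beta> w P)"
      by (intro sum.cong) auto
  qed (auto simp: admissible_interval_def)
  then show ?thesis by (simp add: marking_sum_def sum_distrib_left c_def)
qed

lemma marking_sum_last_quadruple:
  "marking_sum_last a \<beta> w [i, i, i + 1, i + 1] = - marking_sum a \<beta> w"
proof -
  have "admissible_interval (w @ [i, i, i + 1, i + 1]) (length w) (length [i, i, i + 1, i + 1])"
    by (simp add: admissible_interval_def nth_append)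
  then have "marking_sum_last a \<beta> w [i, i, i + 1, i + 1] =
      (\<Sum>P | admissible_marking w P. - marking_monomial a \<beta> w P)"
    using marking_monomial_insert_last[of w _ "[i, i, i + 1, i + 1]" a \<beta>]
    by (subst marking_sum_last_eq) (auto simp: marking_monomial_def intro!: sum.cong)
  then show ?thesis by (simp add: marking_sum_def sum_negf)
qed

section \<open>Recurrences for the sum over all markings\<close>

lemma marking_sum_rec:
  fixes a \<beta> :: "nat \<Rightarrow> 'a::{ring, monoid_mult}" and w :: "nat list"
  assumes "w \<noteq> []"
  defines "m \<equiv> length w"
  defines "T \<equiv> \<lambda>k. marking_sum_last a \<beta> (take (m - k) w) (drop (m - k) w)"
  shows "marking_sum a \<beta> w = T 1 + (if 2 \<le> m then T 2 else 0) +
    (if 4 \<le> m \<and> admissible_interval w (m - 4) 4 then T 4 else 0)"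
proof -
  \<comment> \<open>A final singleton always fits, a final pair needs two letters, and a final
    quadruple needs four letters of the right pattern.\<close>
  have "{k. k \<le> m \<and> admissible_interval w (m - k) k} = {1} \<union> (if 2 \<le> m then {2} else {}) \<union>
      (if 4 \<le> m \<and> admissible_interval w (m - 4) 4 then {4} else {})"
    using assms(1) by (auto simp: m_def admissible_interval_def Suc_le_eq)
  moreover have "marking_sum a \<beta> w = sum T {k. k \<le> m \<and> admissible_interval w (m - k) k}"
    unfolding marking_sum_split_last[OF assms(1)] m_def
    by (rule sum.cong) (auto simp: T_def marking_sum_last_def m_def)
  ultimately show ?thesis by (simp add: add.assoc)
qed

lemma marking_sum_Nil: "marking_sum a \<beta> [] = 1"
proof -
  have "{P. admissible_marking [] P} = {{}}"
    by (auto simp: admissible_marking_def partition_on_empty)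
  then show ?thesis by (simp add: marking_sum_def marking_monomial_def)
qed

lemma marking_sum_letter: "marking_sum a \<beta> [i] = \<beta> i"
  using marking_sum_last_singleton[of a \<beta> "[]" i]
  by (simp add: marking_sum_rec[of "[i]"] marking_sum_Nil)

lemma marking_sum_double_letter: "marking_sum a \<beta> [i, i] = \<beta> i * \<beta> i + a i"
  using marking_sum_last_singleton[of a \<beta> "[i]" i] marking_sum_last_pair[of i i "[]" a \<beta>]
  by (simp add: marking_sum_rec[of "[i, i]"] marking_sum_Nil marking_sum_letter)

text \<open>The last two letters differ, which rules out a final quadruple and gives a final pair
  the weight \<open>1\<close>.\<close>

lemma marking_sum_append_step:
  "marking_sum a \<beta> (w @ [i, i + 1]) = marking_sum a \<beta> (w @ [i]) * \<beta> (i + 1) + marking_sum a \<beta> w"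
proof -
  define v where "v = w @ [i, i + 1]"
  define m where "m = length v"
  have last: "v ! (m - 2) = i" "v ! (m - 1) = i + 1" and "2 \<le> m"
    by (simp_all add: v_def m_def nth_append)
  have "\<not> (4 \<le> m \<and> admissible_interval v (m - 4) 4)"
  proof
    assume *: "4 \<le> m \<and> admissible_interval v (m - 4) 4"
    then have "m - 4 + 2 = m - 2" "m - 4 + 3 = m - 1" by auto
    with * last show False by (simp add: admissible_interval_def)
  qed
  then have "marking_sum a \<beta> v = marking_sum_last a \<beta> (take (m - 1) v) (drop (m - 1) v) +
      marking_sum_last a \<beta> (take (m - 2) v) (drop (m - 2) v)"
    using \<open>2 \<le> m\<close> by (subst marking_sum_rec) (auto simp: m_def)
  then show ?thesis
    using marking_sum_last_singleton[of a \<beta> "w @ [i]" "i + 1"]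
      marking_sum_last_pair[of "i + 1" i w a \<beta>]
    by (simp add: v_def m_def)
qed

text \<open>The three terms come from a final singleton, pair and quadruple; the commutation
  hypothesis is the one needed to bring the weight of the pair to the front.\<close>

lemma marking_sum_append_quadruple:
  assumes "\<And>j. j \<in> set (w @ [i]) \<Longrightarrow> a (i + 1) * a j = a j * a (i + 1)"
  shows "marking_sum a \<beta> (w @ [i, i, i + 1, i + 1]) =
    marking_sum a \<beta> (w @ [i, i, i + 1]) * \<beta> (i + 1) + a (i + 1) * marking_sum a \<beta> (w @ [i, i]) -
    marking_sum a \<beta> w"
proof -
  define v where "v = w @ [i, i, i + 1, i + 1]"
  define m where "m = length v"
  have "4 \<le> m" "2 \<le> m" "m - 4 = length w" by (simp_all add: v_def m_def)
  moreover have "admissible_interval v (length w) 4"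
    by (simp add: admissible_interval_def v_def nth_append)
  ultimately have "marking_sum a \<beta> v = marking_sum_last a \<beta> (take (m - 1) v) (drop (m - 1) v) +
      marking_sum_last a \<beta> (take (m - 2) v) (drop (m - 2) v) +
      marking_sum_last a \<beta> (take (m - 4) v) (drop (m - 4) v)"
    by (subst marking_sum_rec) (auto simp: m_def)
  then have "marking_sum a \<beta> v = marking_sum_last a \<beta> (w @ [i, i, i + 1]) [i + 1] +
      marking_sum_last a \<beta> (w @ [i, i]) [i + 1, i + 1] +
      marking_sum_last a \<beta> w [i, i, i + 1, i + 1]"
    by (simp add: v_def m_def)
  also have "marking_sum_last a \<beta> (w @ [i, i]) [i + 1, i + 1] =
      a (i + 1) * marking_sum a \<beta> (w @ [i, i])"
    using assms by (subst marking_sum_last_pair) auto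
  finally show ?thesis
    unfolding v_def marking_sum_last_singleton marking_sum_last_quadruple by simp
qed

section \<open>The words of the theorem, parity, and the induction\<close>

lemma word_W_0: "word_W 0 = []"
  by (simp add: word_W_def)

lemma word_W_Suc: "word_W (Suc n) = word_W n @ [Suc n, Suc n]"
  by (simp add: word_W_def)

lemma word_W'_Suc: "word_W' (Suc n) = word_W n @ [Suc n]"
  by (simp add: word_W_def word_W'_def)

lemma set_word_W: "set (word_W n) = {1..n}"
  by (induction n) (auto simp: word_W_0 word_W_Suc)

context supercommutative_ring
begin

lemma diff_even: "x \<in> R0 \<Longrightarrow> y \<in> R0 \<Longrightarrow> x - y \<in> R0"
  using add_even[OF _ uminus_even, of x y] by simp

text \<open>Write \<open>1 = y + z\<close> with \<open>y\<close> even and \<open>z\<close> odd.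
  Multiplying by \<open>y\<close> shows that \<open>y * z = y - y * y\<close> is both odd and even,
  hence zero; multiplying by \<open>z\<close> then gives \<open>z = y * z + z * z = 0\<close>. This
  makes \<open>K 0\<close> even.\<close>

lemma one_even: "1 \<in> R0"
proof -
  obtain y z where yz: "y \<in> R0" "z \<in> R1" "1 = y + z"
    using decompose by blast
  have "y * z = y - y * y"
    using arg_cong[OF yz(3), of "\<lambda>t. y * t"] by (simp add: distrib_left algebra_simps)
  then have "y * z \<in> R0 \<inter> R1"
    using yz diff_even even_mult_even even_mult_odd by (metis IntI)
  then have "y * z = 0" using even_Int_odd by blast
  then have "z = 0"
    using arg_cong[OF yz(3), of "\<lambda>t. t * z"] odd_square[OF yz(2)] by (simp add: distrib_right)
  then show ?thesis using yz by simp
qed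

end

theorem theorem1:
  fixes R0 R1 :: "'a::{ring, monoid_mult} set"
    and a \<beta> K L :: "nat \<Rightarrow> 'a"
    and n :: nat
  assumes "supercommutative_ring R0 R1"
    and "\<And>i. i \<ge> 1 \<Longrightarrow> a i \<in> R0"
    and "\<And>i. i \<ge> 1 \<Longrightarrow> \<beta> i \<in> R1"
    and "K 0 = 1" and "K 1 = a 1" and "L 1 = \<beta> 1"
    and "\<And>m. m \<ge> 2 \<Longrightarrow> K m = a m * K (m - 1) - K (m - 2) - \<beta> m * L (m - 1)"
    and "\<And>m. m \<ge> 2 \<Longrightarrow> L m = \<beta> m * K (m - 1) + L (m - 1)"
    and "n \<ge> 1"
  shows "K n = marking_sum a \<beta> (word_W n) \<and> L n = marking_sum a \<beta> (word_W' n)"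
proof -
  interpret supercommutative_ring R0 R1 by fact
  let ?E = "marking_sum a \<beta>"
  \<comment> \<open>The parities are carried along because they justify moving
    \<open>\<beta>\<close> past \<open>K\<close> and \<open>L\<close>. Two consecutive values of
    \<open>K\<close> are kept since its recurrence reaches back two steps.\<close>
  have *: "K m \<in> R0 \<and> K (Suc m) \<in> R0 \<and> L (Suc m) \<in> R1 \<and>
      K m = ?E (word_W m) \<and> K (Suc m) = ?E (word_W (Suc m)) \<and>
      L (Suc m) = ?E (word_W' (Suc m))" for m
  proof (induction m)
    \<comment> \<open>Here \<open>\<beta> 1 * \<beta> 1 = 0\<close> reduces the sum for the word
      \<open>[1, 1]\<close> to \<open>a 1\<close>.\<close>
    case 0
    then show ?case
      using assms(2,3)[of 1] assms(4-6) odd_square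
      by (simp add: one_even word_W_0 word_W_Suc word_W'_Suc marking_sum_Nil marking_sum_letter
          marking_sum_double_letter)
  next
    case (Suc m)
    define i where "i = Suc m"
    have i: "a (i + 1) \<in> R0" "\<beta> (i + 1) \<in> R1" using assms(2,3) by simp_all
    have K: "K (i + 1) = a (i + 1) * K i - K m - \<beta> (i + 1) * L i"
      and L: "L (i + 1) = \<beta> (i + 1) * K i + L i"
      using assms(7,8)[of "i + 1"] by (simp_all add: i_def)
    have IH: "K m \<in> R0" "K i \<in> R0" "L i \<in> R1" "K m = ?E (word_W m)"
      "K i = ?E (word_W m @ [i, i])" "L i = ?E (word_W m @ [i])"
      using Suc.IH unfolding i_def word_W_Suc word_W'_Suc by blast+
    have even: "K (i + 1) \<in> R0" and odd: "L (i + 1) \<in> R1"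
      unfolding K L using i IH
      by (simp_all add: diff_even even_mult_even odd_mult_odd odd_mult_even add_odd)
    have "?E (word_W m @ [i, i, i + 1]) = K i * \<beta> (i + 1) + L i"
      using marking_sum_append_step[of a \<beta> "word_W m @ [i]" i] IH by simp
    also have "\<dots> = L (i + 1)"
      unfolding L using even_commute[of "K i" "\<beta> (i + 1)"] i(2) IH(2) by simp
    finally have EL: "L (i + 1) = ?E (word_W m @ [i, i, i + 1])" ..
    \<comment> \<open>Evenness of \<open>a j\<close> is known only for positive \<open>j\<close>;
      all letters of this prefix lie between \<open>1\<close> and \<open>i\<close>.\<close>
    have comm: "a (i + 1) * a j = a j * a (i + 1)" if "j \<in> set (word_W m @ [i])" for j
      using that i assms(2)[of j] even_commute by (auto simp: set_word_W i_def)
    have "L (i + 1) * \<beta> (i + 1) = - (\<beta> (i + 1) * L (i + 1))"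
      using odd i by (intro odd_anticommute)
    \<comment> \<open>Expanding \<open>L (i + 1)\<close>, the summand containing \<open>K i\<close>
      acquires the factor \<open>\<beta> (i + 1)\<close> twice and vanishes.\<close>
    also have "\<dots> = - (\<beta> (i + 1) * L i)"
      unfolding L using odd_square[OF i(2)] by (simp add: distrib_left mult.assoc[symmetric])
    finally have "?E (word_W m @ [i, i, i + 1, i + 1]) = K (i + 1)"
      unfolding K using marking_sum_append_quadruple[of "word_W m" i a \<beta>, OF comm]
      by (simp add: IH(4,5) EL[symmetric, simplified] algebra_simps)
    then show ?case
      using Suc.IH even odd EL by (auto simp: i_def word_W_Suc word_W'_Suc)
  qed
  show ?thesis using *[of "n - 1"] assms(9) by simp
qed

end
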